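(* Let $Y$ be a real random variable whose moment generating function $E[e^{tY}]$ exists for $|t|<\rho$ for some $\rho>0$, and let $r\ge 0$ be an integer. For every integer $n\ge 0$, $$E\big[Y^{n}\big]=n!\sum_{k=0}^{n}\frac{D_{k+r}^{(r,Y)}}{(k+r)!}(-1)^{k}\binom{r+1}{n-k}.$$
   Context: For an integer $r\ge 0$, the probabilistic $r$-derangement numbers $D_n^{(r,Y)}$ ($n\ge r$) associated with $Y$ are defined by the generating function (for $t$ near $0$) $$\frac{t^{r}}{(1-t)^{r+1}}E\big[e^{-Yt}\big]=\sum_{n=r}^{\infty}D_{n}^{(r,Y)}\frac{t^{n}}{n!}.$$ Here $\binom{r+1}{j}=0$ for $j>r+1$. *)

theory Defs
  imports "HOL-Probability.Probability"
begin

text \<open>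
  The sequence is only determined for indices \<open>n \<ge> r\<close>; the values below \<open>r\<close> are set to \<open>0\<close> so
  that the sequence is unique. The series over \<open>n \<ge> r\<close> is indexed by \<open>k = n - r\<close>.
\<close>

definition r_derangement_gf ::
  "'a measure \<Rightarrow> ('a \<Rightarrow> real) \<Rightarrow> nat \<Rightarrow> (nat \<Rightarrow> real) \<Rightarrow> bool" where
  "r_derangement_gf M Y r D \<longleftrightarrow>
     (\<forall>n<r. D n = 0) \<and>
     (\<forall>\<^sub>F t in nhds 0.
        (\<lambda>k. D (k + r) * t ^ (k + r) / fact (k + r)) sums
          (t ^ r / (1 - t) ^ (r + 1) * prob_space.expectation M (\<lambda>x. exp (- Y x * t))))"

definition r_derangement ::
  "'a measure \<Rightarrow> ('a \<Rightarrow> real) \<Rightarrow> nat \<Rightarrow> nat \<Rightarrow> real" where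
  "r_derangement M Y r = (THE D. r_derangement_gf M Y r D)"

end

theory Submission
  imports Defs
begin

text \<open>
  Why the identity holds. Because the moment generating function is finite near \<open>0\<close>, expectation
  and exponential series may be interchanged (\<open>moment_generating_sums\<close>), so that near \<open>0\<close>
  \[E[e^{-Yt}] = \sum_n (-1)^n \frac{E[Y^n]}{n!} t^n.\]
  Write \<open>A\<close> for this power series and \<open>d k = D (k + r) / fact (k + r)\<close>. After cancelling
  \<open>t ^ r\<close>, the defining relation of the \<open>r\<close>-derangement numbers says that the formal power
  series with coefficients \<open>d\<close> is \<open>A / (1 - X) ^ (r + 1)\<close>. Hence \<open>A\<close> is the product of that
  series with \<open>(1 - X) ^ (r + 1)\<close>, and the claim is the comparison of the coefficients of
  \<open>X ^ n\<close>: the signs \<open>(-1) ^ n\<close> and \<open>(-1) ^ (n - k)\<close> combine to \<open>(-1) ^ k\<close>.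

  Since the numbers are given by a definite description, one also has to know that exactly one
  sequence has the prescribed generating function. Existence holds because
  \<open>A / (1 - X) ^ (r + 1)\<close> has positive radius of convergence (\<open>1 - X\<close> is a unit), and uniqueness
  is the identity theorem for power series (\<open>has_fps_expansion_unique\<close>).
\<close>

section \<open>Power series\<close>

text \<open>
  If \<open>F \<noteq> 0\<close> represented the zero function, so would \<open>F\<close> divided by the highest power of \<open>X\<close>
  it contains, up to the value at \<open>0\<close>. That quotient is continuous at \<open>0\<close> and takes the first
  nonzero coefficient of \<open>F\<close> there, although it vanishes at all other points nearby.
\<close>

lemma has_fps_expansion_zero_imp_zero:
  fixes F :: "'a :: {banach, real_normed_field} fps"
  assumes "(\<lambda>_. 0) has_fps_expansion F"
  shows "F = 0"
proof (rule ccontr)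
  assume "F \<noteq> 0"
  define c where "c = fps_nth F (subdegree F)"
  have "c \<noteq> 0"
    using \<open>F \<noteq> 0\<close> by (simp add: c_def)
  define h where "h = (\<lambda>x :: 'a. if x = 0 then c else 0 / x ^ subdegree F)"
  have "h has_fps_expansion fps_shift (subdegree F) F"
    unfolding h_def by (rule has_fps_expansion_shift[OF assms]) (simp_all add: c_def)
  then have "isCont h 0"
    by (rule has_fps_expansion_imp_continuous)
  then have "h \<midarrow>0\<rightarrow> c"
    by (simp add: isCont_def h_def)
  moreover have "h \<midarrow>0\<rightarrow> 0"
    by (rule tendsto_eventually) (simp add: eventually_at_filter h_def)
  ultimately show False
    using \<open>c \<noteq> 0\<close> LIM_unique by blast
qed

lemma has_fps_expansion_unique:
  fixes F G :: "'a :: {banach, real_normed_field} fps"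
  assumes "f has_fps_expansion F" "f has_fps_expansion G"
  shows "F = G"
proof -
  have "(\<lambda>_. 0) has_fps_expansion F - G"
    using has_fps_expansion_diff[OF assms] by simp
  then show ?thesis
    using has_fps_expansion_zero_imp_zero by fastforce
qed

lemma has_fps_expansion_imp_sums:
  fixes F :: "'a :: {banach, real_normed_div_algebra} fps"
  assumes "f has_fps_expansion F"
  shows "\<forall>\<^sub>F x in nhds 0. (\<lambda>n. fps_nth F n * x ^ n) sums f x"
proof -
  have "\<forall>\<^sub>F x in nhds 0. x \<in> eball 0 (fps_conv_radius F)"
    using assms
    by (intro eventually_nhds_in_open) (auto simp: has_fps_expansion_def zero_ereal_def)
  moreover have "\<forall>\<^sub>F x in nhds 0. eval_fps F x = f x"
    using assms by (simp add: has_fps_expansion_def)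
  ultimately show ?thesis
  proof eventually_elim
    case (elim x)
    then show ?case
      using sums_eval_fps[of x F] by simp
  qed
qed

lemma has_fps_expansion_power:
  fixes F :: "'a :: {banach, real_normed_field} fps"
  assumes "f has_fps_expansion F"
  shows "(\<lambda>x. f x ^ m) has_fps_expansion F ^ m"
  by (induction m) (auto intro!: has_fps_expansion_mult assms)

lemma fps_nth_one_minus_X_power:
  "fps_nth ((1 - fps_X :: 'a :: field_char_0 fps) ^ m) j = (-1) ^ j * of_nat (m choose j)"
proof -
  have "(1 - fps_X :: 'a fps) ^ m = fps_binomial (of_nat m) oo (fps_const (-1) * fps_X)"
    using one_minus_const_fps_X_power[of "1 :: 'a" m] by (simp flip: fps_const_neg)
  also have "\<dots> = Abs_fps (\<lambda>n. (-1) ^ n * fps_nth (fps_binomial (of_nat m)) n)"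
    by (rule fps_compose_linear)
  finally show ?thesis
    by (simp add: binomial_gbinomial)
qed

section \<open>Moments and the moment generating function\<close>

lemma exp_abs_le: "exp \<bar>u\<bar> \<le> exp u + exp (- u)" for u :: real
  by (cases "u \<ge> 0") auto

lemma abs_partial_exp_le: "(\<Sum>k<m. \<bar>u\<bar> ^ k / fact k) \<le> exp \<bar>u\<bar>" for u :: real
proof -
  have "(\<lambda>k. \<bar>u\<bar> ^ k / fact k) sums exp \<bar>u\<bar>"
    using exp_converges[of "\<bar>u\<bar>"] by (simp add: divide_inverse mult.commute)
  then show ?thesis
    by (intro sum_le_suminf[THEN order_trans]) (auto simp: sums_iff)
qed

lemma integrable_moment:
  fixes Y :: "'a \<Rightarrow> real"
  assumes [measurable]: "Y \<in> borel_measurable M"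
    and "\<rho> > 0" and mgf: "\<And>t. \<bar>t\<bar> < \<rho> \<Longrightarrow> integrable M (\<lambda>x. exp (t * Y x))"
  shows "integrable M (\<lambda>x. Y x ^ k)"
proof -
  define s where "s = \<rho> / 2"
  have s: "s > 0" "\<bar>s\<bar> < \<rho>" "\<bar>-s\<bar> < \<rho>"
    using \<open>\<rho> > 0\<close> by (auto simp: s_def)
  \<comment> \<open>Up to the factor \<open>fact k / s ^ k\<close>, \<open>\<bar>Y x\<bar> ^ k\<close> is one term of the series of \<open>exp (s * \<bar>Y x\<bar>)\<close>.\<close>
  have "norm (Y x ^ k) \<le> norm (fact k / s ^ k * (exp (s * Y x) + exp (- s * Y x)))" for x
  proof -
    have "\<bar>s * Y x\<bar> ^ k / fact k \<le> (\<Sum>i<Suc k. \<bar>s * Y x\<bar> ^ i / fact i)"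
      by (rule member_le_sum) auto
    also have "\<dots> \<le> exp (s * Y x) + exp (- s * Y x)"
      using abs_partial_exp_le[of "s * Y x" "Suc k"] exp_abs_le[of "s * Y x"] by simp
    finally have "\<bar>s * Y x\<bar> ^ k / fact k \<le> exp (s * Y x) + exp (- s * Y x)" .
    then have "\<bar>Y x\<bar> ^ k \<le> fact k / s ^ k * (exp (s * Y x) + exp (- s * Y x))"
      using \<open>s > 0\<close> by (simp add: abs_mult power_mult_distrib field_simps)
    then show ?thesis
      using \<open>s > 0\<close> by (simp add: power_abs abs_mult)
  qed
  moreover have "integrable M (\<lambda>x. fact k / s ^ k * (exp (s * Y x) + exp (- s * Y x)))"
    using mgf[OF s(2)] mgf[OF s(3)] by (intro integrable_mult_right integrable_add) auto
  ultimately show ?thesis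
    by (intro Bochner_Integration.integrable_bound[of M _ "\<lambda>x. Y x ^ k"]) auto
qed

text \<open>
  The partial sums of the exponential series of \<open>t * Y x\<close> are bounded by \<open>exp \<bar>t * Y x\<bar>\<close>, hence
  by \<open>exp (t * Y x) + exp (- t * Y x)\<close>, which is integrable. Dominated convergence applies.
\<close>

lemma moment_generating_sums:
  fixes Y :: "'a \<Rightarrow> real"
  assumes [measurable]: "Y \<in> borel_measurable M"
    and mgf: "\<And>t. \<bar>t\<bar> < \<rho> \<Longrightarrow> integrable M (\<lambda>x. exp (t * Y x))"
    and t: "\<bar>t\<bar> < \<rho>"
  shows "(\<lambda>k. (\<integral>x. Y x ^ k \<partial>M) / fact k * t ^ k) sums (\<integral>x. exp (t * Y x) \<partial>M)"
proof -
  have "\<rho> > 0" and t': "\<bar>-t\<bar> < \<rho>"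
    using t by auto
  note moment = integrable_moment[OF assms(1) \<open>\<rho> > 0\<close> mgf]
  have "(\<lambda>m. \<integral>x. (\<Sum>k<m. (t * Y x) ^ k / fact k) \<partial>M) \<longlonglongrightarrow> (\<integral>x. exp (t * Y x) \<partial>M)"
  proof (rule integral_dominated_convergence[where w = "\<lambda>x. exp (t * Y x) + exp (- t * Y x)"])
    show "integrable M (\<lambda>x. exp (t * Y x) + exp (- t * Y x))"
      using mgf[OF t] mgf[OF t'] by simp
    show "AE x in M. (\<lambda>m. \<Sum>k<m. (t * Y x) ^ k / fact k) \<longlonglongrightarrow> exp (t * Y x)"
      using exp_converges[where 'a = real]
      by (simp add: sums_def divide_inverse mult.commute)
    show "AE x in M. norm (\<Sum>k<m. (t * Y x) ^ k / fact k) \<le> exp (t * Y x) + exp (- t * Y x)" for m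
    proof (rule AE_I2)
      fix x
      have "norm (\<Sum>k<m. (t * Y x) ^ k / fact k) \<le> (\<Sum>k<m. \<bar>t * Y x\<bar> ^ k / fact k)"
        by (rule sum_norm_le) (simp add: power_abs)
      also have "\<dots> \<le> exp (t * Y x) + exp (- t * Y x)"
        using abs_partial_exp_le[of "t * Y x" m] exp_abs_le[of "t * Y x"] by simp
      finally show "norm (\<Sum>k<m. (t * Y x) ^ k / fact k) \<le> exp (t * Y x) + exp (- t * Y x)" .
    qed
  qed measurable
  moreover have "(\<integral>x. (\<Sum>k<m. (t * Y x) ^ k / fact k) \<partial>M) =
      (\<Sum>k<m. (\<integral>x. Y x ^ k \<partial>M) / fact k * t ^ k)" for m
    using moment by (simp add: power_mult_distrib mult.commute)
  ultimately show ?thesis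
    by (simp add: sums_def)
qed

lemma has_fps_expansion_negative_mgf:
  fixes Y :: "'a \<Rightarrow> real"
  assumes "Y \<in> borel_measurable M"
    and "\<rho> > 0" and "\<And>t. \<bar>t\<bar> < \<rho> \<Longrightarrow> integrable M (\<lambda>x. exp (t * Y x))"
  shows "(\<lambda>t. \<integral>x. exp (- Y x * t) \<partial>M) has_fps_expansion
    Abs_fps (\<lambda>k. (-1) ^ k * (\<integral>x. Y x ^ k \<partial>M) / fact k)"
proof (rule has_fps_expansionI)
  have "\<forall>\<^sub>F t in nhds 0. t \<in> {-\<rho><..<\<rho>}"
    using \<open>\<rho> > 0\<close> by (intro eventually_nhds_in_open) auto
  then show "\<forall>\<^sub>F t in nhds 0.
      (\<lambda>n. fps_nth (Abs_fps (\<lambda>k. (-1) ^ k * (\<integral>x. Y x ^ k \<partial>M) / fact k)) n * t ^ n)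
        sums (\<integral>x. exp (- Y x * t) \<partial>M)"
  proof eventually_elim
    case (elim t)
    then have "(\<lambda>k. (\<integral>x. Y x ^ k \<partial>M) / fact k * (- t) ^ k) sums (\<integral>x. exp (- t * Y x) \<partial>M)"
      by (intro moment_generating_sums[OF assms(1,3)]) auto
    then show ?case
      by (simp add: power_minus[of t] mult_ac)
  qed
qed

section \<open>The r-derangement numbers as coefficients\<close>

text \<open>
  The terms of index below \<open>r\<close> vanish, so the series over \<open>n \<ge> r\<close> is the full exponential
  generating series of \<open>D\<close>. Keeping the factor \<open>t ^ r\<close> avoids a division by \<open>0\<close> at \<open>t = 0\<close>.
\<close>

lemma r_derangement_gf_iff:
  "r_derangement_gf M Y r D \<longleftrightarrow>
     (\<forall>n<r. D n = 0) \<and>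
     (\<lambda>t. t ^ r / (1 - t) ^ (r + 1) * (\<integral>x. exp (- Y x * t) \<partial>M))
       has_fps_expansion Abs_fps (\<lambda>n. D n / fact n)"
proof (cases "\<forall>n<r. D n = 0")
  case True
  define g where "g = (\<lambda>t. t ^ r / (1 - t) ^ (r + 1) * (\<integral>x. exp (- Y x * t) \<partial>M))"
  have shift: "(\<lambda>k. D (k + r) * t ^ (k + r) / fact (k + r)) sums s \<longleftrightarrow>
      (\<lambda>n. fps_nth (Abs_fps (\<lambda>n. D n / fact n)) n * t ^ n) sums s" for t s
    using sums_iff_shift[of "\<lambda>n. D n / fact n * t ^ n" r s] True by simp
  have "r_derangement_gf M Y r D \<longleftrightarrow>
      (\<forall>\<^sub>F t in nhds 0. (\<lambda>n. fps_nth (Abs_fps (\<lambda>n. D n / fact n)) n * t ^ n) sums g t)"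
    unfolding r_derangement_gf_def shift g_def using True by simp
  also have "\<dots> \<longleftrightarrow> g has_fps_expansion Abs_fps (\<lambda>n. D n / fact n)"
    using has_fps_expansionI has_fps_expansion_imp_sums by blast
  finally show ?thesis
    using True by (simp add: g_def)
qed (unfold r_derangement_gf_def, blast)

text \<open>
  This evaluates the definite description: the quotient series exists and, multiplied by
  \<open>X ^ r\<close>, has the required vanishing coefficients, while two admissible sequences would give
  two expansions of one function.
\<close>

lemma r_derangement_eq_fps_nth:
  assumes A: "(\<lambda>t. \<integral>x. exp (- Y x * t) \<partial>M) has_fps_expansion A"
  shows "r_derangement M Y r (k + r) / fact (k + r) =
    fps_nth (inverse ((1 - fps_X) ^ (r + 1)) * A) k"
proof -
  define g where "g = (\<lambda>t. t ^ r / (1 - t) ^ (r + 1) * (\<integral>x. exp (- Y x * t) \<partial>M))"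
  define G where "G = fps_X ^ r * (inverse ((1 - fps_X) ^ (r + 1)) * A)"
  define D where "D = (\<lambda>n. fact n * fps_nth G n)"
  have "(\<lambda>t. t ^ r * (inverse ((1 - t) ^ (r + 1)) * (\<integral>x. exp (- Y x * t) \<partial>M))) has_fps_expansion G"
    unfolding G_def
    by (intro has_fps_expansion_mult has_fps_expansion_inverse has_fps_expansion_power
        has_fps_expansion_fps_X_power has_fps_expansion_diff has_fps_expansion_1
        has_fps_expansion_fps_X A)
      (simp add: fps_nth_power_0)
  then have G: "g has_fps_expansion G"
    by (simp add: g_def divide_inverse mult.assoc)
  have D_eq: "Abs_fps (\<lambda>n. D n / fact n) = G"
    by (simp add: fps_eq_iff D_def)
  have "r_derangement M Y r = D"
    unfolding r_derangement_def
  proof (rule the_equality)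
    show "r_derangement_gf M Y r D"
      using G unfolding r_derangement_gf_iff D_eq
      by (simp add: g_def D_def G_def fps_X_power_mult_nth)
  next
    fix D' assume "r_derangement_gf M Y r D'"
    then have "g has_fps_expansion Abs_fps (\<lambda>n. D' n / fact n)"
      by (simp add: r_derangement_gf_iff g_def)
    from has_fps_expansion_unique[OF this G] show "D' = D"
      by (simp add: fps_eq_iff D_def fun_eq_iff field_simps)
  qed
  then show ?thesis
    by (simp add: D_def G_def fps_X_power_mult_nth)
qed

theorem theorem2p7:
  fixes M :: "'a measure" and Y :: "'a \<Rightarrow> real" and \<rho> :: real and r n :: nat
  assumes "prob_space M"
    and "Y \<in> borel_measurable M"
    and "\<rho> > 0"
    and "\<And>t. \<bar>t\<bar> < \<rho> \<Longrightarrow> integrable M (\<lambda>x. exp (t * Y x))"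
  shows "prob_space.expectation M (\<lambda>x. Y x ^ n) =
    fact n * (\<Sum>k=0..n. r_derangement M Y r (k + r) / fact (k + r)
                          * (-1) ^ k * real ((r + 1) choose (n - k)))"
proof -
  define A where "A = Abs_fps (\<lambda>k. (-1) ^ k * (\<integral>x. Y x ^ k \<partial>M) / fact k)"
  define d where "d = (\<lambda>k. r_derangement M Y r (k + r) / fact (k + r))"
  define P where "P = (1 - fps_X :: real fps) ^ (r + 1)"
  have d: "d k = fps_nth (inverse P * A) k" for k
    unfolding d_def P_def A_def
    by (rule r_derangement_eq_fps_nth[OF has_fps_expansion_negative_mgf[OF assms(2-4)]])
  have "fps_nth P 0 \<noteq> 0"
    by (simp add: P_def fps_nth_power_0)
  then have "inverse P * P = 1"
    by (rule inverse_mult_eq_1)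
  then have "A = inverse P * A * P"
    by (metis mult.assoc mult.commute mult_1)
  then have "fps_nth A n = (\<Sum>k=0..n. d k * fps_nth P (n - k))"
    by (metis (no_types, lifting) d fps_mult_nth sum.cong)
  then have "(-1) ^ n * ((\<integral>x. Y x ^ n \<partial>M) / fact n) =
      (\<Sum>k=0..n. d k * ((-1) ^ (n - k) * real ((r + 1) choose (n - k))))"
    unfolding P_def fps_nth_one_minus_X_power by (simp add: A_def)
  then have "(-1) ^ n * ((-1) ^ n * ((\<integral>x. Y x ^ n \<partial>M) / fact n)) =
      (\<Sum>k=0..n. (-1) ^ n * (d k * ((-1) ^ (n - k) * real ((r + 1) choose (n - k)))))"
    by (simp add: sum_distrib_left)
  also have "\<dots> = (\<Sum>k=0..n. d k * (-1) ^ k * real ((r + 1) choose (n - k)))"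
  proof (rule sum.cong[OF refl])
    fix k assume "k \<in> {0..n}"
    then have "(-1 :: real) ^ n * (-1) ^ (n - k) = (-1) ^ k"
      by (auto simp: minus_one_power_iff)
    then show "(-1) ^ n * (d k * ((-1) ^ (n - k) * real ((r + 1) choose (n - k)))) =
        d k * (-1) ^ k * real ((r + 1) choose (n - k))"
      by (metis (no_types, opaque_lifting) mult.assoc mult.left_commute)
  qed
  finally have "(\<integral>x. Y x ^ n \<partial>M) / fact n =
      (\<Sum>k=0..n. d k * (-1) ^ k * real ((r + 1) choose (n - k)))"
    by (simp flip: mult.assoc power_mult_distrib)
  then show ?thesis
    by (simp add: d_def field_simps)
qed

end
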